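(* Let $f:\mathbb{R}^q\to\mathbb{R}^m$ be a piecewise affine function with corresponding polyhedral subdivision $\mathfrak{P}$ of $\mathbb{R}^q$. Let $x\in\mathbb{R}^q$ and let $y\in|\mathfrak{P}(x)|$, where $|\mathfrak{P}(x)|$ is the union of all $P\in\mathfrak{P}$ with $x\in P$. Then $$df(x)(y-x)=-df(y)(x-y),$$ where $df(\cdot)$ denotes the B-derivative.
   Context: A continuous function $f:\mathbb{R}^q\to\mathbb{R}^m$ is piecewise affine if there are finitely many affine functions $f_1,\dots,f_k:\mathbb{R}^q\to\mathbb{R}^m$ with $f(x)\in\{f_1(x),\dots,f_k(x)\}$ for every $x$. A polyhedral subdivision of $\mathbb{R}^q$ is a finite collection $\mathfrak{P}=\{P_1,\dots,P_l\}$ of polyhedral convex sets such that each $P_i$ has dimension $q$, the union of the $P_i$ is $\mathbb{R}^q$, and for $i\ne j$ the intersection $P_i\cap P_j$ is either empty or a common proper face of both (a proper face of $P$ is a nonempty face different from $P$). $\mathfrak{P}$ corresponds to $f$ if $f$ coincides with an affine function on each $P\in\mathfrak{P}$ (such a subdivision always exists). $\mathfrak{P}(x)=\{P\in\mathfrak{P}: x\in P\}$. A locally Lipschitz function $g$ is B-differentiable at $x$ if there is a positively homogeneous function $G=dg(x)$ with $g(x+v)=g(x)+G(v)+o(v)$; then $dg(x)(h)$ is the directional derivative of $g$ at $x$ along $h$. A piecewise affine function is B-differentiable everywhere. *)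

theory Defs
  imports "HOL-Analysis.Analysis"
begin

definition affine_map :: "('a::real_vector \<Rightarrow> 'b::real_vector) \<Rightarrow> bool" where
  "affine_map h \<longleftrightarrow> (\<exists>A b. linear A \<and> h = (\<lambda>x. A x + b))"

definition piecewise_affine :: "('a::real_normed_vector \<Rightarrow> 'b::real_normed_vector) \<Rightarrow> bool" where
  "piecewise_affine f \<longleftrightarrow>
     continuous_on UNIV f \<and>
     (\<exists>F. finite F \<and> (\<forall>h\<in>F. affine_map h) \<and> (\<forall>x. \<exists>h\<in>F. f x = h x))"

text \<open>The library predicate \<open>face_of\<close> also counts the empty set and the whole set as faces.\<close>

definition proper_face_of :: "'a::real_vector set \<Rightarrow> 'a set \<Rightarrow> bool" where
  "proper_face_of F P \<longleftrightarrow> F face_of P \<and> F \<noteq> {} \<and> F \<noteq> P"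

definition polyhedral_subdivision :: "'a::euclidean_space set set \<Rightarrow> bool" where
  "polyhedral_subdivision \<P> \<longleftrightarrow>
     finite \<P> \<and>
     (\<forall>P\<in>\<P>. polyhedron P \<and> aff_dim P = int DIM('a)) \<and>
     \<Union>\<P> = UNIV \<and>
     (\<forall>P\<in>\<P>. \<forall>Q\<in>\<P>. P \<noteq> Q \<longrightarrow>
        P \<inter> Q = {} \<or> (proper_face_of (P \<inter> Q) P \<and> proper_face_of (P \<inter> Q) Q))"

definition corresponds_to ::
    "'a::real_vector set set \<Rightarrow> ('a \<Rightarrow> 'b::real_vector) \<Rightarrow> bool" where
  "corresponds_to \<P> f \<longleftrightarrow> (\<forall>P\<in>\<P>. \<exists>h. affine_map h \<and> (\<forall>x\<in>P. f x = h x))"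

definition cells_at :: "'a set set \<Rightarrow> 'a \<Rightarrow> 'a set set" where
  "cells_at \<P> x = {P \<in> \<P>. x \<in> P}"

definition locally_lipschitz :: "('a::metric_space \<Rightarrow> 'b::metric_space) \<Rightarrow> bool" where
  "locally_lipschitz g \<longleftrightarrow> (\<forall>x. \<exists>u>0. \<exists>L. L-lipschitz_on (cball x u) g)"

definition positively_homogeneous :: "('a::real_vector \<Rightarrow> 'b::real_vector) \<Rightarrow> bool" where
  "positively_homogeneous G \<longleftrightarrow> (\<forall>t\<ge>0. \<forall>v. G (t *\<^sub>R v) = t *\<^sub>R G v)"

definition has_B_derivative ::
    "('a::real_normed_vector \<Rightarrow> 'b::real_normed_vector) \<Rightarrow> ('a \<Rightarrow> 'b) \<Rightarrow> 'a \<Rightarrow> bool" where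
  "has_B_derivative g G x \<longleftrightarrow>
     locally_lipschitz g \<and> positively_homogeneous G \<and>
     ((\<lambda>v. norm (g (x + v) - g x - G v) / norm v) \<longlongrightarrow> 0) (at 0)"

text \<open>The value is meaningful only where a B-derivative exists; it is then unique,
  see \<open>has_B_derivative_unique\<close>.\<close>

definition B_derivative ::
    "('a::real_normed_vector \<Rightarrow> 'b::real_normed_vector) \<Rightarrow> 'a \<Rightarrow> 'a \<Rightarrow> 'b" where
  "B_derivative g x = (THE G. has_B_derivative g G x)"

lemma has_B_derivative_unique:
  assumes "has_B_derivative g G x" and "has_B_derivative g H x"
  shows "G = H"
proof
  fix u
  show "G u = H u"
  proof (cases "u = 0")
    case True
    have "G (0 *\<^sub>R u) = 0 *\<^sub>R G u" "H (0 *\<^sub>R u) = 0 *\<^sub>R H u"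
      using assms unfolding has_B_derivative_def positively_homogeneous_def by blast+
    with True show ?thesis by simp
  next
    case False
    define R where "R = (\<lambda>K v. norm (g (x + v) - g x - K v) / norm v)"
    have lim: "((\<lambda>v. R G v + R H v) \<longlongrightarrow> 0) (at 0)"
      using assms tendsto_add[of "R G" 0 "at 0" "R H" 0]
      unfolding has_B_derivative_def R_def by simp
    have ray: "filterlim (\<lambda>t. t *\<^sub>R u) (at 0) (at_right (0::real))"
      unfolding filterlim_at
      using False by (auto intro!: tendsto_eq_intros eventually_at_right_less
          eventually_mono[OF eventually_at_right_less[of 0]])
    have lim': "((\<lambda>t. R G (t *\<^sub>R u) + R H (t *\<^sub>R u)) \<longlongrightarrow> 0) (at_right (0::real))"
      using filterlim_compose[OF lim ray] .
    have bound: "norm (G u - H u) / norm u \<le> R G (t *\<^sub>R u) + R H (t *\<^sub>R u)" if "t > 0" for t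
    proof -
      have "G (t *\<^sub>R u) = t *\<^sub>R G u" "H (t *\<^sub>R u) = t *\<^sub>R H u"
        using assms that unfolding has_B_derivative_def positively_homogeneous_def by auto
      then have "norm (G u - H u) / norm u
          = norm (G (t *\<^sub>R u) - H (t *\<^sub>R u)) / norm (t *\<^sub>R u)"
        using that by (simp flip: scaleR_diff_right)
      also have "\<dots> \<le> R G (t *\<^sub>R u) + R H (t *\<^sub>R u)"
        unfolding R_def add_divide_distrib[symmetric]
        by (rule divide_right_mono) (norm, simp)
      finally show ?thesis .
    qed
    have "norm (G u - H u) / norm u \<le> 0"
      by (rule tendsto_lowerbound[OF lim'])
        (auto intro!: eventually_mono[OF eventually_at_right_less[of 0]] bound)
    with False show ?thesis by (simp add: divide_le_0_iff)
  qed
qed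

end

theory Submission
  imports Defs
begin

text \<open>
  Near \<open>x\<close> only the cells containing \<open>x\<close> matter, and \<open>f\<close> is affine on the segment from \<open>x\<close> to any
  point of such a cell. Hence \<open>f (x + v) = f x + G v\<close> holds exactly for all small \<open>v\<close>, with \<open>G\<close>
  read off on a small sphere and extended by homogeneity. For \<open>y\<close> in a cell containing \<open>x\<close> this gives
  \<open>df(x)(y - x) = f y - f x\<close>, which is antisymmetric in \<open>x\<close> and \<open>y\<close>.
\<close>

text \<open>The linear part does not appear, so the identity carries over to any function agreeing
  with \<open>h\<close> at the three points involved.\<close>

lemma affine_map_segment:
  assumes "affine_map h"
  shows "h (x + t *\<^sub>R v) = h x + t *\<^sub>R (h (x + v) - h x)"
proof -
  obtain A b where A: "linear A" "h = (\<lambda>x. A x + b)"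
    using assms unfolding affine_map_def by blast
  show ?thesis
    unfolding A(2) using A(1) by (simp add: linear_add linear_scale)
qed

lemma affine_map_lipschitz:
  fixes h :: "'a::euclidean_space \<Rightarrow> 'b::real_normed_vector"
  assumes "affine_map h"
  shows "\<exists>L. L-lipschitz_on UNIV h"
proof -
  obtain A b where A: "linear A" "h = (\<lambda>x. A x + b)"
    using assms unfolding affine_map_def by blast
  obtain L where L: "L > 0" "\<And>x. norm (A x) \<le> norm x * L"
    using bounded_linear.pos_bounded A(1) linear_conv_bounded_linear by blast
  have "L-lipschitz_on UNIV h"
  proof (rule lipschitz_onI)
    fix x y
    have "dist (h x) (h y) = norm (A (x - y))"
      using A(1) by (simp add: A(2) dist_norm linear_diff)
    then show "dist (h x) (h y) \<le> L * dist x y"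
      using L(2)[of "x - y"] by (simp add: dist_norm mult.commute)
  qed (use L in simp)
  then show ?thesis ..
qed

text \<open>A segment between two points is cut by the cover into finitely many closed pieces, so
  the claim reduces to gluing Lipschitz bounds on an interval.\<close>

lemma lipschitz_on_finite_closed_cover:
  fixes f :: "'a::real_normed_vector \<Rightarrow> 'b::metric_space"
  assumes "finite \<P>" and cl: "\<And>P. P \<in> \<P> \<Longrightarrow> closed P" and cover: "\<Union>\<P> = UNIV"
    and lip: "\<And>P. P \<in> \<P> \<Longrightarrow> L-lipschitz_on P f" and "0 \<le> L"
  shows "L-lipschitz_on UNIV f"
proof (rule lipschitz_onI)
  fix x y :: 'a
  define \<gamma> where "\<gamma> t = x + t *\<^sub>R (y - x)" for t :: real
  have \<gamma>: "dist (\<gamma> s) (\<gamma> t) = dist s t * dist x y" for s t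
  proof -
    have "\<gamma> s - \<gamma> t = (s - t) *\<^sub>R (y - x)" by (simp add: \<gamma>_def algebra_simps)
    then show ?thesis by (simp add: dist_norm norm_minus_commute)
  qed
  \<comment> \<open>Since \<gamma> stretches distances by \<open>dist x y\<close>, the constant
    scales likewise; the parameters 0 and 1 then give the bound for \<open>x\<close> and
    \<open>y\<close>.\<close>
  have "(L * dist x y)-lipschitz_on {0..1} (f \<circ> \<gamma>)"
  proof (rule lipschitz_on_closed_Union[of \<P> "L * dist x y" "\<lambda>P. \<gamma> -` P"])
    fix P assume P: "P \<in> \<P>"
    show "(L * dist x y)-lipschitz_on (\<gamma> -` P) (f \<circ> \<gamma>)"
    proof (rule lipschitz_onI)
      fix s t assume "s \<in> \<gamma> -` P" "t \<in> \<gamma> -` P"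
      then show "dist ((f \<circ> \<gamma>) s) ((f \<circ> \<gamma>) t) \<le> L * dist x y * dist s t"
        using lipschitz_onD[OF lip[OF P], of "\<gamma> s" "\<gamma> t"] by (simp add: \<gamma> mult_ac)
    qed (use \<open>0 \<le> L\<close> in simp)
    show "closed (\<gamma> -` P)"
      unfolding \<gamma>_def by (rule closed_vimage[OF cl[OF P]]) (intro continuous_intros)
  next
    show "{0..1} \<subseteq> (\<Union>P\<in>\<P>. \<gamma> -` P)" using cover by blast
  qed (use assms in auto)
  from lipschitz_onD[OF this, of 0 1] show "dist (f x) (f y) \<le> L * dist x y"
    by (simp add: \<gamma>_def)
qed fact

text \<open>The cells missing \<open>x\<close> are finitely many closed sets, so the complement of
  their union is an open neighbourhood of \<open>x\<close>.\<close>

lemma polyhedral_subdivision_ball: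
  fixes \<P> :: "'a::euclidean_space set set"
  assumes "polyhedral_subdivision \<P>"
  obtains r where "r > 0" "ball x r \<subseteq> \<Union>(cells_at \<P> x)"
proof -
  have "open (- \<Union>{P \<in> \<P>. x \<notin> P})"
    using assms unfolding polyhedral_subdivision_def
    by (intro open_Compl closed_Union) (auto simp: polyhedron_imp_closed)
  then obtain r where r: "r > 0" "ball x r \<subseteq> - \<Union>{P \<in> \<P>. x \<notin> P}"
    by (rule openE) auto
  moreover have "- \<Union>{P \<in> \<P>. x \<notin> P} \<subseteq> \<Union>(cells_at \<P> x)"
    using assms unfolding polyhedral_subdivision_def cells_at_def by blast
  ultimately show ?thesis using that by blast
qed

context
  fixes f :: "'a::euclidean_space \<Rightarrow> 'b::real_normed_vector" and \<P> :: "'a set set"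
  assumes sub: "polyhedral_subdivision \<P>" and cor: "corresponds_to \<P> f"
begin

text \<open>By convexity the segment stays in one cell containing both endpoints, where a single
  affine map represents \<open>f\<close>.\<close>

lemma corresponds_to_segment:
  assumes "x + v \<in> \<Union>(cells_at \<P> x)" "0 \<le> t" "t \<le> 1"
  shows "f (x + t *\<^sub>R v) = f x + t *\<^sub>R (f (x + v) - f x)"
proof -
  obtain P where P: "P \<in> \<P>" "x \<in> P" "x + v \<in> P"
    using assms(1) unfolding cells_at_def by blast
  obtain h where h: "affine_map h" "\<And>z. z \<in> P \<Longrightarrow> f z = h z"
    using cor P(1) unfolding corresponds_to_def by blast
  have "convex P"
    using sub P(1) by (simp add: polyhedral_subdivision_def polyhedron_imp_convex)
  then have "(1 - t) *\<^sub>R x + t *\<^sub>R (x + v) \<in> P"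
    using P assms by (intro convexD) auto
  then have "x + t *\<^sub>R v \<in> P" by (simp add: algebra_simps)
  then show ?thesis using P h(2) affine_map_segment[OF h(1)] by simp
qed

text \<open>Needed because \<open>has_B_derivative\<close> includes this condition. The bound
  obtained is even global.\<close>

lemma corresponds_to_locally_lipschitz: "locally_lipschitz f"
proof -
  have fin: "finite \<P>" and cl: "\<And>P. P \<in> \<P> \<Longrightarrow> closed P" and cover: "\<Union>\<P> = UNIV"
    using sub by (auto simp: polyhedral_subdivision_def polyhedron_imp_closed)
  have "\<exists>L. L-lipschitz_on P f" if "P \<in> \<P>" for P
  proof -
    obtain h where h: "affine_map h" "\<And>z. z \<in> P \<Longrightarrow> f z = h z"
      using cor \<open>P \<in> \<P>\<close> unfolding corresponds_to_def by blast
    obtain L where "L-lipschitz_on UNIV h"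
      using affine_map_lipschitz[OF h(1)] by blast
    then have "L-lipschitz_on P h" by (rule lipschitz_on_subset) simp
    then show ?thesis using h(2) by (metis lipschitz_on_transform)
  qed
  then obtain L where L: "\<And>P. P \<in> \<P> \<Longrightarrow> (L P)-lipschitz_on P f" by metis
  \<comment> \<open>The sum dominates each \<open>L P\<close> because all of them are
    nonnegative.\<close>
  define M where "M = (\<Sum>P\<in>\<P>. L P)"
  have nn: "0 \<le> L P" if "P \<in> \<P>" for P using L[OF that] by (rule lipschitz_on_nonneg)
  have "M-lipschitz_on UNIV f"
  proof (rule lipschitz_on_finite_closed_cover[OF fin cl cover])
    show "M-lipschitz_on P f" if "P \<in> \<P>" for P
      using L[OF that] by (rule lipschitz_on_mono)
        (auto simp: M_def intro!: member_le_sum that fin nn)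
    show "0 \<le> M" unfolding M_def by (simp add: sum_nonneg nn)
  qed
  then have "M-lipschitz_on (cball x 1) f" for x by (rule lipschitz_on_subset) simp
  then show ?thesis unfolding locally_lipschitz_def by (meson zero_less_one)
qed

text \<open>The radius \<open>s\<close> and the exact expansion are exported along with
  \<open>G\<close>, so that values of \<open>G\<close> can later be computed without limits.\<close>

lemma corresponds_to_has_B_derivative:
  obtains G s where "has_B_derivative f G x" "s > 0"
    "\<And>v. norm v \<le> s \<Longrightarrow> f (x + v) = f x + G v"
proof -
  obtain r where r: "r > 0" "ball x r \<subseteq> \<Union>(cells_at \<P> x)"
    using polyhedral_subdivision_ball[OF sub] .
  \<comment> \<open>Strictly below \<open>r\<close>, so that the sphere of radius \<open>s\<close>
    lies in the open ball.\<close>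
  define s where "s = r / 2"
  have s: "s > 0" "s < r" using r(1) by (simp_all add: s_def)
  define G where "G v = (norm v / s) *\<^sub>R (f (x + (s / norm v) *\<^sub>R v) - f x)" for v
  have exact: "f (x + v) = f x + G v" if "norm v \<le> s" for v
  proof (cases "v = 0")
    case True
    then show ?thesis by (simp add: G_def)
  next
    case False
    have "x + (s / norm v) *\<^sub>R v \<in> ball x r" using False s by (simp add: dist_norm)
    then have "x + (s / norm v) *\<^sub>R v \<in> \<Union>(cells_at \<P> x)" using r(2) by blast
    \<comment> \<open>The point on the sphere is scaled back to \<open>v\<close> by the factor
      \<open>norm v / s\<close>, which is at most 1.\<close>
    from corresponds_to_segment[OF this, of "norm v / s"]
    show ?thesis using False s that by (simp add: G_def)
  qed
  have "positively_homogeneous G"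
    unfolding positively_homogeneous_def
  proof (intro allI impI)
    fix t :: real and v assume "t \<ge> 0"
    then show "G (t *\<^sub>R v) = t *\<^sub>R G v"
      by (cases "t = 0") (simp_all add: G_def)
  qed
  moreover have "((\<lambda>v. norm (f (x + v) - f x - G v) / norm v) \<longlongrightarrow> 0) (at 0)"
  proof (rule tendsto_eventually)
    show "\<forall>\<^sub>F v in at 0. norm (f (x + v) - f x - G v) / norm v = 0"
      unfolding eventually_at using s(1) by (intro exI[of _ s]) (simp add: exact)
  qed
  ultimately have "has_B_derivative f G x"
    unfolding has_B_derivative_def using corresponds_to_locally_lipschitz by blast
  then show ?thesis using that s(1) exact by blast
qed

text \<open>The point \<open>y\<close> may be far from \<open>x\<close>, so the local expansion is
  used at \<open>x + t *\<^sub>R (y - x)\<close> for a small \<open>t\<close>, which homogeneity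
  then cancels.\<close>

lemma B_derivative_in_cell:
  assumes "y \<in> \<Union>(cells_at \<P> x)"
  shows "B_derivative f x (y - x) = f y - f x"
proof -
  obtain G s where G: "has_B_derivative f G x" "s > 0"
    "\<And>v. norm v \<le> s \<Longrightarrow> f (x + v) = f x + G v"
    using corresponds_to_has_B_derivative by metis
  have "B_derivative f x = G"
    unfolding B_derivative_def using G(1) has_B_derivative_unique by blast
  \<comment> \<open>The minimum keeps the point on the segment; the added 1 keeps the denominator
    positive when \<open>y = x\<close>.\<close>
  define t where "t = min 1 (s / (norm (y - x) + 1))"
  have t: "0 < t" "t \<le> 1" using G(2) by (auto simp: t_def add_nonneg_pos)
  have "t * (norm (y - x) + 1) \<le> s"
    by (simp add: t_def flip: pos_le_divide_eq add: add_nonneg_pos)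
  then have "norm (t *\<^sub>R (y - x)) \<le> s" using t by (simp add: distrib_left)
  then have "f x + G (t *\<^sub>R (y - x)) = f x + t *\<^sub>R (f y - f x)"
    using G(3) corresponds_to_segment[of x "y - x" t] assms t by simp
  moreover have "G (t *\<^sub>R (y - x)) = t *\<^sub>R G (y - x)"
    using G(1) t unfolding has_B_derivative_def positively_homogeneous_def by simp
  ultimately show ?thesis using t \<open>B_derivative f x = G\<close> by simp
qed

end

theorem theorem2p2:
  fixes f :: "real ^ 'q \<Rightarrow> real ^ 'm"
    and \<P> :: "(real ^ 'q) set set"
    and x y :: "real ^ 'q"
  assumes "piecewise_affine f"
    and "polyhedral_subdivision \<P>"
    and "corresponds_to \<P> f"
    and "y \<in> \<Union>(cells_at \<P> x)"
  shows "B_derivative f x (y - x) = - B_derivative f y (x - y)"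
proof -
  \<comment> \<open>A cell witnessing the assumption contains both points, so the lemma also applies
    with \<open>x\<close> and \<open>y\<close> exchanged.\<close>
  have "x \<in> \<Union>(cells_at \<P> y)"
    using assms(4) unfolding cells_at_def by blast
  then show ?thesis
    using B_derivative_in_cell[OF assms(2,3)] assms(4) by simp
qed

end
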